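(* If $(E,\mathrm{dep})$ is a DSC, then $(E,\mathsf{rdp}(E))$ is an antimatroid. Furthermore, a subset $X\subseteq E$ is complete in $(E,\mathrm{dep})$ if and only if $X$ is feasible in $(E,\mathsf{rdp}(E))$.
   Context: $P(A)$ denotes the power set of $A$. A preDSC is a pair $(E,\mathrm{dep})$ with $E$ a finite set and $\mathrm{dep}:E\to P(P(E))$ a function; elements of $\mathrm{dep}(e)$ are called depsets of $e$. For $X,Y\subseteq E$ write $X\,\mathrm{rch}\,Y$ if $X\subseteq Y$ and for every $y\in Y$ there is $D\in\mathrm{dep}(y)$ with $D\subseteq X$. A subset $X\subseteq E$ is reachable if there is a finite sequence of subsets with $\varnothing\,\mathrm{rch}\,X_0\,\mathrm{rch}\cdots\mathrm{rch}\,X_n\,\mathrm{rch}\,X$. $\mathsf{rdp}(E)$ is the set of reachable subsets. A subset $X$ is complete if every $e\in X$ has a depset $D\in\mathrm{dep}(e)$ with $D\subseteq X$. A DSC is a preDSC which is irredundant ($D_0\subseteq D_1$ with $D_0,D_1\in\mathrm{dep}(e)$ implies $D_0=D_1$), acyclic ($e\notin D$ for all $D\in\mathrm{dep}(e)$), nonsingular ($\mathrm{dep}(e)\neq\varnothing$ for all $e$) and has complete depsets (all $D\in\mathrm{dep}(e)$ are complete). An antimatroid is a pair $(E,\mathcal F)$ with $E$ a finite set and $\mathcal F\subseteq P(E)$ a nonempty family, whose members are called feasible sets, such that: (A1) $A,B\in\mathcal F$ implies $A\cup B\in\mathcal F$; (A2) if $\varnothing\neq S\in\mathcal F$ then there is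 $x\in S$ with $S\setminus\{x\}\in\mathcal F$; (A3) $E=\bigcup_{A\in\mathcal F}A$. *)

theory Defs
  imports Main
begin

text \<open>
  A preDSC is given by a carrier \<open>E\<close> and a total function \<open>dep\<close>, of which only the values
  on \<open>E\<close> matter: every notion below evaluates \<open>dep\<close> only at elements of \<open>E\<close>.
\<close>

locale preDSC =
  fixes E :: "'a set" and dep :: "'a \<Rightarrow> 'a set set"
  assumes finite_carrier: "finite E"
    and depsets_subset: "e \<in> E \<Longrightarrow> dep e \<subseteq> Pow E"

definition rch :: "'a set \<Rightarrow> ('a \<Rightarrow> 'a set set) \<Rightarrow> 'a set \<Rightarrow> 'a set \<Rightarrow> bool" where
  "rch E dep X Y \<longleftrightarrow>
     X \<subseteq> E \<and> Y \<subseteq> E \<and> X \<subseteq> Y \<and> (\<forall>y\<in>Y. \<exists>D\<in>dep y. D \<subseteq> X)"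

definition reachable :: "'a set \<Rightarrow> ('a \<Rightarrow> 'a set set) \<Rightarrow> 'a set \<Rightarrow> bool" where
  "reachable E dep X \<longleftrightarrow>
     (\<exists>(n::nat) S. rch E dep {} (S 0) \<and>
        (\<forall>i<n. rch E dep (S i) (S (Suc i))) \<and> rch E dep (S n) X)"

definition rdp :: "'a set \<Rightarrow> ('a \<Rightarrow> 'a set set) \<Rightarrow> 'a set set" where
  "rdp E dep = {X. X \<subseteq> E \<and> reachable E dep X}"

definition complete :: "'a set \<Rightarrow> ('a \<Rightarrow> 'a set set) \<Rightarrow> 'a set \<Rightarrow> bool" where
  "complete E dep X \<longleftrightarrow> X \<subseteq> E \<and> (\<forall>e\<in>X. \<exists>D\<in>dep e. D \<subseteq> X)"

locale DSC = preDSC +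
  assumes irredundant:
      "\<lbrakk>e \<in> E; D0 \<in> dep e; D1 \<in> dep e; D0 \<subseteq> D1\<rbrakk> \<Longrightarrow> D0 = D1"
    and acyclic: "\<lbrakk>e \<in> E; D \<in> dep e\<rbrakk> \<Longrightarrow> e \<notin> D"
    and nonsingular: "e \<in> E \<Longrightarrow> dep e \<noteq> {}"
    and complete_depsets: "\<lbrakk>e \<in> E; D \<in> dep e\<rbrakk> \<Longrightarrow> complete E dep D"

text \<open>The members of \<open>F\<close> are the feasible sets of the antimatroid.\<close>

locale antimatroid =
  fixes E :: "'a set" and F :: "'a set set"
  assumes finite_ground: "finite E"
    and feasible_subset: "F \<subseteq> Pow E"
    and nonempty: "F \<noteq> {}"
    and union_closed: "\<lbrakk>A \<in> F; B \<in> F\<rbrakk> \<Longrightarrow> A \<union> B \<in> F"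
    and accessible: "\<lbrakk>S \<in> F; S \<noteq> {}\<rbrakk> \<Longrightarrow> \<exists>x\<in>S. S - {x} \<in> F"
    and covering: "E = \<Union>F"

end

theory Submission
  imports Defs
begin

text \<open>
  Completeness is a local condition that is visibly closed under unions, so the antimatroid
  axioms are checked for the family of complete sets, which is then identified with the family of
  reachable sets.  Everything rests on one growth property: if \<open>Y \<subset> X\<close> are complete, then
  some element of \<open>X - Y\<close> already has a depset inside \<open>Y\<close> (lemma \<open>exists_depset_inside\<close>).
  The reason is descent: a depset \<open>D\<close> of \<open>e\<close> that leaves \<open>Y\<close> contains some \<open>d \<notin> Y\<close>, and since
  \<open>D\<close> is complete, \<open>d\<close> has a depset in \<open>D\<close>, which omits \<open>d\<close> by acyclicity and so is smaller.

  Applied to a maximal proper complete subset \<open>Y\<close> of \<open>X\<close>, the growth property shows that \<open>Y\<close>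
  is \<open>X\<close> minus one point (lemma \<open>complete_accessible\<close>).  This is axiom (A2), and it also makes
  every complete set reachable: for complete \<open>X\<close> and \<open>X - {x}\<close>, acyclicity puts a depset of \<open>x\<close>
  inside \<open>X - {x}\<close>, so \<open>X - {x}\<close> reaches \<open>X\<close> in one step.  Conversely the last step of a chain
  that ends in \<open>X\<close> provides the depsets that make \<open>X\<close> complete.
\<close>

lemma complete_empty: "complete E dep {}"
  by (simp add: complete_def)

lemma complete_Un: "complete E dep X \<Longrightarrow> complete E dep Y \<Longrightarrow> complete E dep (X \<union> Y)"
  unfolding complete_def by (meson Un_iff Un_least le_supI1 le_supI2)

lemma complete_insert:
  assumes "complete E dep Y" "e \<in> E" "D \<in> dep e" "D \<subseteq> Y"
  shows "complete E dep (insert e Y)"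
  unfolding complete_def
proof (intro conjI ballI)
  show "insert e Y \<subseteq> E"
    using assms by (simp add: complete_def)
  show "\<exists>D\<in>dep y. D \<subseteq> insert e Y" if "y \<in> insert e Y" for y
  proof -
    have "\<exists>D\<in>dep y. D \<subseteq> Y"
      using assms that by (auto simp: complete_def)
    then show ?thesis
      by blast
  qed
qed

lemma reachable_empty: "reachable E dep {}"
  unfolding reachable_def rch_def by (intro exI[of _ 0] exI[of _ "\<lambda>_. {}"]) simp

lemma reachable_step:
  assumes "reachable E dep X" "rch E dep X Y"
  shows "reachable E dep Y"
proof -
  from assms(1) obtain n S where S: "rch E dep {} (S 0)"
      "\<forall>i<n. rch E dep (S i) (S (Suc i))" "rch E dep (S n) X"
    unfolding reachable_def by blast
  let ?T = "S(Suc n := X)"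
  have "rch E dep (?T i) (?T (Suc i))" if "i < Suc n" for i
    using S that by (cases "i = n") auto
  with S assms(2) show ?thesis
    unfolding reachable_def by (intro exI[of _ "Suc n"] exI[of _ ?T]) simp
qed

lemma reachable_imp_complete:
  assumes "reachable E dep X"
  shows "complete E dep X"
proof -
  from assms obtain Y where "rch E dep Y X"
    unfolding reachable_def by blast
  then show ?thesis
    unfolding rch_def complete_def by (meson order_trans)
qed

context DSC
begin

lemma finite_complete: "complete E dep X \<Longrightarrow> finite X"
  by (simp add: complete_def finite_subset[OF _ finite_carrier])

lemma complete_carrier: "complete E dep E"
proof -
  have "\<exists>D\<in>dep e. D \<subseteq> E" if "e \<in> E" for e
    using nonsingular[OF that] depsets_subset[OF that] by blast
  then show ?thesis
    by (simp add: complete_def)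
qed

text \<open>
  A smallest depset of an element outside \<open>Y\<close> must lie in \<open>Y\<close>: any of its elements outside
  \<open>Y\<close> would have a strictly smaller depset.  Only depsets contained in \<open>X\<close> compete, so that the
  descent never leaves \<open>X\<close>.
\<close>

lemma exists_depset_inside:
  assumes X: "complete E dep X" and "\<not> X \<subseteq> Y"
  obtains e D where "e \<in> X - Y" "D \<in> dep e" "D \<subseteq> Y"
proof -
  define P where "P = (\<lambda>(e, D). e \<in> X - Y \<and> D \<in> dep e \<and> D \<subseteq> X)"
  obtain x A where "x \<in> X - Y" "A \<in> dep x" "A \<subseteq> X"
    using assms unfolding complete_def by blast
  then have "P (x, A)"
    unfolding P_def by simp
  then obtain p where "P p" and min: "\<And>q. P q \<Longrightarrow> card (snd p) \<le> card (snd q)"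
    using ex_has_least_nat[of P "(x, A)" "\<lambda>q. card (snd q)"] by blast
  then obtain e D where p: "p = (e, D)" and e: "e \<in> X - Y" and D: "D \<in> dep e" "D \<subseteq> X"
    unfolding P_def by (cases p) auto
  have "e \<in> E"
    using e X unfolding complete_def by blast
  then have cD: "complete E dep D"
    using D complete_depsets by blast
  have "D \<subseteq> Y"
  proof (rule ccontr)
    assume "\<not> D \<subseteq> Y"
    then obtain d where d: "d \<in> D" "d \<notin> Y"
      by blast
    with cD obtain D' where D': "D' \<in> dep d" "D' \<subseteq> D" and "d \<in> E"
      unfolding complete_def by blast
    with d have "D' \<subset> D"
      using acyclic by blast
    then have "card D' < card D"
      using finite_complete[OF cD] psubset_card_mono by blast
    moreover have "P (d, D')"
      using d D D' unfolding P_def by auto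
    ultimately show False
      using min[of "(d, D')"] p by simp
  qed
  with e D that show thesis
    by blast
qed

text \<open>
  Remove a maximal proper complete subset: by the growth property it can be enlarged by a single
  element of \<open>X\<close>, and by maximality the enlarged set is all of \<open>X\<close>.
\<close>

lemma complete_accessible:
  assumes X: "complete E dep X" and "X \<noteq> {}"
  shows "\<exists>x\<in>X. complete E dep (X - {x})"
proof -
  let ?C = "{Y. Y \<subset> X \<and> complete E dep Y}"
  have "finite ?C"
    using finite_complete[OF X] by (auto intro: finite_subset[of _ "Pow X"])
  moreover have "{} \<in> ?C"
    using \<open>X \<noteq> {}\<close> by (auto simp: complete_empty)
  ultimately obtain Y where Y: "Y \<subset> X" "complete E dep Y"
    and max: "\<forall>Z\<in>?C. Y \<subseteq> Z \<longrightarrow> Y = Z"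
    using finite_has_maximal[of ?C] by auto
  obtain e D where e: "e \<in> X - Y" "D \<in> dep e" "D \<subseteq> Y"
    using exists_depset_inside[OF X, of Y] Y(1) by blast
  have "e \<in> E"
    using e X unfolding complete_def by blast
  then have "complete E dep (insert e Y)"
    using complete_insert[OF Y(2) _ e(2,3)] by simp
  with max e(1) Y(1) have "insert e Y = X"
    by (metis (no_types, lifting) CollectI DiffE insertI1 insert_subset psubsetE psubsetI subset_insertI)
  with e(1) have "X - {e} = Y"
    by blast
  with e(1) Y(2) show ?thesis
    by (intro bexI[of _ e]) simp_all
qed

lemma rch_remove:
  assumes "complete E dep X" "complete E dep (X - {x})"
  shows "rch E dep (X - {x}) X"
proof -
  have "\<exists>D\<in>dep y. D \<subseteq> X - {x}" if y: "y \<in> X" for y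
  proof (cases "y = x")
    case True
    with y assms(1) obtain D where D: "D \<in> dep x" "D \<subseteq> X" and "x \<in> E"
      unfolding complete_def by blast
    then have "D \<subseteq> X - {x}"
      using acyclic[of x D] by blast
    with D True show ?thesis
      by blast
  next
    case False
    with y assms(2) show ?thesis
      by (simp add: complete_def)
  qed
  with assms show ?thesis
    by (auto simp: rch_def complete_def)
qed

lemma complete_imp_reachable:
  assumes "complete E dep X"
  shows "reachable E dep X"
  using finite_complete[OF assms] assms
proof (induction X rule: finite_psubset_induct)
  case (psubset X)
  show ?case
  proof (cases "X = {}")
    case True
    then show ?thesis
      by (simp add: reachable_empty)
  next
    case False
    with psubset.prems obtain x where x: "x \<in> X" "complete E dep (X - {x})"
      using complete_accessible by blast
    then have "reachable E dep (X - {x})"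
      using psubset.IH[of "X - {x}"] by blast
    then show ?thesis
      by (rule reachable_step) (rule rch_remove[OF psubset.prems x(2)])
  qed
qed

lemma rdp_eq_complete: "rdp E dep = {X. complete E dep X}"
proof -
  have "X \<subseteq> E \<and> reachable E dep X \<longleftrightarrow> complete E dep X" for X
  proof -
    have "complete E dep X \<Longrightarrow> X \<subseteq> E"
      by (simp add: complete_def)
    then show ?thesis
      using complete_imp_reachable reachable_imp_complete by metis
  qed
  then show ?thesis
    by (simp add: rdp_def)
qed

lemma antimatroid_complete: "antimatroid E {X. complete E dep X}"
proof
  show "finite E"
    by (rule finite_carrier)
  show "{X. complete E dep X} \<subseteq> Pow E"
    by (auto simp: complete_def)
  show "{X. complete E dep X} \<noteq> {}"
    using complete_empty[of E dep] by blast
  show "A \<union> B \<in> {X. complete E dep X}"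
    if "A \<in> {X. complete E dep X}" "B \<in> {X. complete E dep X}" for A B
    using that complete_Un[of E dep A B] by simp
  show "\<exists>x\<in>S. S - {x} \<in> {X. complete E dep X}"
    if "S \<in> {X. complete E dep X}" "S \<noteq> {}" for S
    using that complete_accessible[of S] by simp
  show "E = \<Union> {X. complete E dep X}"
    using complete_carrier \<open>{X. complete E dep X} \<subseteq> Pow E\<close> by blast
qed

end

theorem proposition3p13:
  fixes E :: "'a set" and dep :: "'a \<Rightarrow> 'a set set"
  assumes "DSC E dep"
  shows "antimatroid E (rdp E dep) \<and>
    (\<forall>X. X \<subseteq> E \<longrightarrow> (complete E dep X \<longleftrightarrow> X \<in> rdp E dep))"
proof -
  interpret DSC E dep
    by (rule assms)
  show ?thesis
    using antimatroid_complete by (simp add: rdp_eq_complete)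
qed

end
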